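(* Let $n\ge 1$ and let $\varphi$ be defined for $\lambda=(\lambda_1,\lambda_2,\lambda_3)\in L(3,n)\setminus E_{3,n}$ by the following rules: 1. if $\lambda\in E_{3,\lambda_1}$, then $\varphi(\lambda)=(\lambda_1+1,\lambda_2,\lambda_3)$; otherwise (i.e. $\lambda\notin E_{3,\lambda_1}$): 2. $\varphi(\lambda)=(\lambda_1,\lambda_2+1,\lambda_3)$ if $\lambda_2+\lambda_3\equiv 0\pmod 2$ and $(\lambda_1-1,\lambda_2+1,\lambda_3)\notin E_{3,\lambda_1-1}$; 3. $\varphi(\lambda)=(\lambda_1,\lambda_2+1,\lambda_3)$ if $\lambda_2+\lambda_3\not\equiv 0\pmod 2$ and $(\lambda_1-1,\lambda_2,\lambda_3+1)\in E_{3,\lambda_1-1}$; 4. $\varphi(\lambda)=(\lambda_1,\lambda_2,\lambda_3+1)$ if $\lambda_2+\lambda_3\not\equiv 0\pmod 2$ and $(\lambda_1-1,\lambda_2,\lambda_3+1)\notin E_{3,\lambda_1-1}$. Then $\varphi$ is a bijection from $L(3,n)\setminus E_{3,n}$ to $L(3,n)\setminus S_{3,n}$. Therefore $\varphi$ defines order matchings $$L_0(3,n)\to L_1(3,n)\to\cdots\to L_j(3,n)\leftarrow L_{j+1}(3,n)\leftarrow\cdots\leftarrow L_{3n}(3,n),\qquad j=\lfloor 3n/2\rfloor,$$ that is, for $i<j$ the restriction of $\varphi$ is an injection $L_i(3,n)\to L_{i+1}(3,n)$ with $\varphi(\lambda)>\lambda$, and for $j\le i<3n$ the restriction of $\varphi^{-1}$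 is an injection $L_{i+1}(3,n)\to L_i(3,n)$ with $\varphi^{-1}(\mu)<\mu$. Consequently $L(3,n)$ is rank unimodal and Sperner.
   Context: $\mathbb{N}=\{0,1,2,\dots\}$. $L(3,n)$ is the poset of integer triples $\lambda=(\lambda_1,\lambda_2,\lambda_3)$ with $n\ge\lambda_1\ge\lambda_2\ge\lambda_3\ge 0$, ordered componentwise; it is ranked by $|\lambda|=\lambda_1+\lambda_2+\lambda_3$, and $L_i(3,n)$ is the set of its elements of rank $i$. The dual of $\lambda$ in $L(3,n)$ is $\lambda^*=(n-\lambda_3,n-\lambda_2,n-\lambda_1)$. For every integer $n\ge 0$ set $$S_{3,n}=\{(4k+\ell,2k,0): k\in\mathbb{N},\ \ell\in\mathbb{N}\setminus\{1\},\ 4k+\ell\le n,\ 6k+\ell\le 3n/2\},\qquad E_{3,n}=\{\lambda^*:\lambda\in S_{3,n}\},$$ the dual being taken in $L(3,n)$. In particular $E_{3,\lambda_1}$ and $E_{3,\lambda_1-1}$ are these sets with $n$ replaced by $\lambda_1$ and $\lambda_1-1$; a triple that is not a partition belongs to no $E_{3,p}$. It is part of the claim that the rules define $\varphi$ on all of $L(3,n)\setminus E_{3,n}$ (the case $\lambda\notin E_{3,\lambda_1}$, $\lambda_2+\lambda_3$ even, $(\lambda_1-1,\lambda_2+1,\lambda_3)\in E_{3,\lambda_1-1}$ never occurs). A ranked poset is rank unimodal if its sequence of rank sizes is unimodal, and Sperner if the maximum size of an antichain equals the maximum rank size. *)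

theory Defs
  imports Complex_Main "HOL-Library.Product_Order"
begin

(* Triples (a, b, c) are ordered componentwise by the product order of
   HOL-Library.Product_Order. *)
type_synonym triple = "int \<times> int \<times> int"

fun weight :: "triple \<Rightarrow> int" where
  "weight (a, b, c) = a + b + c"

definition L3 :: "int \<Rightarrow> triple set" where
  "L3 n = {(a, b, c). n \<ge> a \<and> a \<ge> b \<and> b \<ge> c \<and> c \<ge> 0}"

definition L3_level :: "int \<Rightarrow> int \<Rightarrow> triple set" where
  "L3_level n i = {x \<in> L3 n. weight x = i}"

fun dual3 :: "int \<Rightarrow> triple \<Rightarrow> triple" where
  "dual3 n (a, b, c) = (n - c, n - b, n - a)"

(* Both sets are empty for n < 0 (since l and k range over nat), so E3 (a - 1) is
   meaningful for a = 0. As S3 n is contained in L3 n, so is E3 n: a triple that is not a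
   partition lies in no E3 p. The last condition is 6 k + l \<le> 3 n / 2. *)
definition S3 :: "int \<Rightarrow> triple set" where
  "S3 n = {(4 * int k + int l, 2 * int k, 0) | k l :: nat.
      l \<noteq> 1 \<and> 4 * int k + int l \<le> n \<and> 2 * (6 * int k + int l) \<le> 3 * n}"

definition E3 :: "int \<Rightarrow> triple set" where
  "E3 n = dual3 n ` S3 n"

(* The rules leave one case open; there the value is left unspecified. *)
fun phi :: "triple \<Rightarrow> triple" where
  "phi (a, b, c) =
    (if (a, b, c) \<in> E3 a then (a + 1, b, c)
     else if even (b + c) then
       (if (a - 1, b + 1, c) \<notin> E3 (a - 1) then (a, b + 1, c) else undefined)
     else
       (if (a - 1, b, c + 1) \<in> E3 (a - 1) then (a, b + 1, c) else (a, b, c + 1)))"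

(* The following notions are meant for a finite nonempty poset P with integer-valued rank
   function r of minimal value 0, so that the ranks run from 0 to Max (r ` P). *)
definition rank_size :: "'a set \<Rightarrow> ('a \<Rightarrow> int) \<Rightarrow> int \<Rightarrow> nat" where
  "rank_size P r i = card {x \<in> P. r x = i}"

definition rank_unimodal :: "'a set \<Rightarrow> ('a \<Rightarrow> int) \<Rightarrow> bool" where
  "rank_unimodal P r \<longleftrightarrow>
    (\<exists>m \<in> {0..Max (r ` P)}.
      mono_on {0..m} (rank_size P r) \<and> antimono_on {m..Max (r ` P)} (rank_size P r))"

definition antichain :: "'a::order set \<Rightarrow> bool" where
  "antichain A \<longleftrightarrow> (\<forall>x\<in>A. \<forall>y\<in>A. x \<le> y \<longrightarrow> x = y)"

definition sperner :: "'a::order set \<Rightarrow> ('a \<Rightarrow> int) \<Rightarrow> bool" where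
  "sperner P r \<longleftrightarrow>
    Max (card ` {A. A \<subseteq> P \<and> antichain A}) = Max (rank_size P r ` {0..Max (r ` P)})"

end

theory Submission
  imports Defs
begin

text \<open>
  Eliminating the parameters \<open>k\<close> and \<open>l\<close> shows that \<^const>\<open>S3\<close> and \<^const>\<open>E3\<close> are cut out by
  linear conditions on the entries together with one parity condition (lemmas \<open>S3_iff\<close> and
  \<open>E3_iff\<close>). The first entry of an element of \<open>E3 n\<close> is \<open>n\<close>; call a triple \<open>(a, b, c)\<close>
  exceptional if it lies in \<open>E3 a\<close>.

  The rules for \<^const>\<open>phi\<close> are designed to exclude collisions. If two different triples had the
  same image, comparing the parities of \<open>b + c\<close> and \<open>a - b\<close> leaves three pairs of rules. In each of
  them one rule makes some triple exceptional, directly or by \<open>E3_shift\<close>, and the other rule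
  excludes this (\<open>inj_on_phi\<close>). The same inequalities show that the image stays
  within \<open>L3 n\<close> and avoids \<open>S3 n\<close> (\<open>phi_mem\<close>). Since duality is a bijection from \<open>S3 n\<close> to \<open>E3 n\<close>, the two
  complements have the same finite size, so injectivity is all that is needed for bijectivity.

  Every element of \<open>E3 n\<close> has weight at least \<open>3 n / 2\<close> and every element of \<open>S3 n\<close> has weight at
  most \<open>3 n / 2\<close>. Hence \<^const>\<open>phi\<close> is defined on all levels below the middle one, and its inverse on
  all levels above it, and following them towards the middle decomposes the poset into chains that
  all meet the middle level. An antichain meets each chain at most once, which gives the Sperner
  property (\<open>antichain_card_le_middle_level\<close>); unimodality is immediate from the injections between consecutive levels.
\<close>

section \<open>Matchings towards a middle level\<close>

text \<open>
  If \<open>g\<close> moves each point one step closer to the points at distance \<open>0\<close>, injectively on each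
  distance class, then two points with the same destination lie on one orbit of \<open>g\<close>: injectivity
  can be undone step by step along the common part of their paths. The relation \<open>R\<close> is kept
  abstract because the steps go up below the middle level and down above it.
\<close>

lemma orbit_map_to_centre:
  fixes g :: "'a \<Rightarrow> 'a" and d :: "'a \<Rightarrow> nat" and R :: "'a \<Rightarrow> 'a \<Rightarrow> bool"
  assumes step: "\<And>x m. x \<in> P \<Longrightarrow> d x = Suc m \<Longrightarrow> g x \<in> P \<and> d (g x) = m \<and> R x (g x)"
    and inj: "\<And>m. inj_on g {x \<in> P. d x = Suc m}"
    and R: "reflp R" "transp R"
  obtains f where "\<And>x. x \<in> P \<Longrightarrow> f x \<in> P \<and> d (f x) = 0 \<and> R x (f x)"
    and "\<And>x y. x \<in> P \<Longrightarrow> y \<in> P \<Longrightarrow> f x = f y \<Longrightarrow> R x y \<or> R y x"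
proof -
  have iter: "(g ^^ k) x \<in> P \<and> d ((g ^^ k) x) = m \<and> R x ((g ^^ k) x)"
    if "x \<in> P" "d x = m + k" for k m x
    using that
  proof (induction k arbitrary: m)
    case 0
    then show ?case using R(1) by (simp add: reflpD)
  next
    case (Suc k)
    have k: "(g ^^ k) x \<in> P" "d ((g ^^ k) x) = Suc m" "R x ((g ^^ k) x)"
      using Suc.IH[of "Suc m"] Suc.prems by auto
    then show ?case
      using step[OF k(1,2)] transpD[OF R(2) k(3)] by simp
  qed
  have iter_inj: "x = y"
    if "x \<in> P" "y \<in> P" "d x = m" "d y = m" "(g ^^ m) x = (g ^^ m) y" for m x y
    using that
  proof (induction m arbitrary: x y)
    case (Suc m)
    have "(g ^^ m) (g x) = (g ^^ m) (g y)"
      using Suc.prems(5) by (simp add: funpow_swap1)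
    with Suc.prems step[of x m] step[of y m] have "g x = g y"
      by (metis Suc.IH)
    then show ?case
      using inj[of m] Suc.prems by (auto dest: inj_onD)
  qed simp
  have later: "R y x"
    if "x \<in> P" "y \<in> P" "d x \<le> d y" "(g ^^ d x) x = (g ^^ d y) y" for x y
  proof -
    define k where "k = d y - d x"
    have dy: "d y = d x + k" using that by (simp add: k_def)
    note i = iter[OF \<open>y \<in> P\<close> dy]
    have "x = (g ^^ k) y"
    proof (rule iter_inj)
      show "(g ^^ d x) x = (g ^^ d x) ((g ^^ k) y)"
        using that(4) by (simp add: dy funpow_add)
    qed (use i that in auto)
    with i show ?thesis by simp
  qed
  show thesis
  proof (rule that[of "\<lambda>x. (g ^^ d x) x"])
    show "(g ^^ d x) x \<in> P \<and> d ((g ^^ d x) x) = 0 \<and> R x ((g ^^ d x) x)" if "x \<in> P" for x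
      using iter[OF that, of 0] by simp
    show "R x y \<or> R y x" if "x \<in> P" "y \<in> P" "(g ^^ d x) x = (g ^^ d y) y" for x y
      using later[of x y] later[of y x] that by (cases "d x \<le> d y") auto
  qed
qed

lemma mono_on_int_interval:
  fixes f :: "int \<Rightarrow> 'b::preorder"
  assumes "\<And>i. l \<le> i \<Longrightarrow> i < u \<Longrightarrow> f i \<le> f (i + 1)"
  shows "mono_on {l..u} f"
proof (rule mono_onI)
  fix r s assume "r \<in> {l..u}" "s \<in> {l..u}" "r \<le> s"
  from \<open>r \<le> s\<close> have "s \<le> u \<longrightarrow> f r \<le> f s"
  proof (induction s rule: int_ge_induct)
    case (step i)
    with assms[of i] \<open>r \<in> {l..u}\<close> show ?case by (auto intro: order_trans)
  qed simp
  with \<open>s \<in> {l..u}\<close> show "f r \<le> f s" by simp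
qed

lemma antimono_on_int_interval:
  fixes f :: "int \<Rightarrow> 'b::preorder"
  assumes "\<And>i. l \<le> i \<Longrightarrow> i < u \<Longrightarrow> f (i + 1) \<le> f i"
  shows "antimono_on {l..u} f"
proof (rule monotone_onI)
  fix r s assume "r \<in> {l..u}" "s \<in> {l..u}" "r \<le> s"
  from \<open>r \<le> s\<close> have "s \<le> u \<longrightarrow> f s \<le> f r"
  proof (induction s rule: int_ge_induct)
    case (step i)
    with assms[of i] \<open>r \<in> {l..u}\<close> show ?case by (auto intro: order_trans)
  qed simp
  with \<open>s \<in> {l..u}\<close> show "f s \<le> f r" by simp
qed

text \<open>
  The two halves are treated by \<open>orbit_map_to_centre\<close>, and the two maps to level \<open>j\<close> are glued.
  Two points with the same destination are comparable, also when they lie on different sides of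
  level \<open>j\<close>, because then the destination lies between them. So the glued map is injective on
  every antichain.
\<close>

lemma antichain_card_le_middle_level:
  fixes P :: "'a::order set" and r :: "'a \<Rightarrow> int"
  assumes fin: "finite P"
    and up: "\<And>x. x \<in> P \<Longrightarrow> r x < j \<Longrightarrow> U x \<in> P \<and> r (U x) = r x + 1 \<and> x \<le> U x"
    and up_inj: "\<And>i. i < j \<Longrightarrow> inj_on U {x \<in> P. r x = i}"
    and down: "\<And>x. x \<in> P \<Longrightarrow> j < r x \<Longrightarrow> D x \<in> P \<and> r (D x) = r x - 1 \<and> D x \<le> x"
    and down_inj: "\<And>i. j < i \<Longrightarrow> inj_on D {x \<in> P. r x = i}"
    and A: "A \<subseteq> P" "antichain A"
  shows "card A \<le> rank_size P r j"
proof -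
  have up_step: "U x \<in> {x \<in> P. r x \<le> j} \<and> nat (j - r (U x)) = m \<and> x \<le> U x"
    if "x \<in> {x \<in> P. r x \<le> j}" "nat (j - r x) = Suc m" for x m
    using that up[of x] by auto
  have up_inj': "inj_on U {x \<in> {x \<in> P. r x \<le> j}. nat (j - r x) = Suc m}" for m
    by (rule inj_on_subset[OF up_inj[of "j - int (Suc m)"]]) auto
  obtain f where f: "\<And>x. x \<in> {x \<in> P. r x \<le> j} \<Longrightarrow>
        f x \<in> {x \<in> P. r x \<le> j} \<and> nat (j - r (f x)) = 0 \<and> x \<le> f x"
      "\<And>x y. x \<in> {x \<in> P. r x \<le> j} \<Longrightarrow> y \<in> {x \<in> P. r x \<le> j} \<Longrightarrow>
        f x = f y \<Longrightarrow> x \<le> y \<or> y \<le> x"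
    by (rule orbit_map_to_centre[where P = "{x \<in> P. r x \<le> j}" and d = "\<lambda>x. nat (j - r x)"
          and R = "(\<le>)", OF up_step up_inj']) (auto intro: reflpI transpI)
  have down_step: "D x \<in> {x \<in> P. j \<le> r x} \<and> nat (r (D x) - j) = m \<and> x \<ge> D x"
    if "x \<in> {x \<in> P. j \<le> r x}" "nat (r x - j) = Suc m" for x m
    using that down[of x] by auto
  have down_inj': "inj_on D {x \<in> {x \<in> P. j \<le> r x}. nat (r x - j) = Suc m}" for m
    by (rule inj_on_subset[OF down_inj[of "j + int (Suc m)"]]) auto
  obtain h where h: "\<And>x. x \<in> {x \<in> P. j \<le> r x} \<Longrightarrow>
        h x \<in> {x \<in> P. j \<le> r x} \<and> nat (r (h x) - j) = 0 \<and> x \<ge> h x"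
      "\<And>x y. x \<in> {x \<in> P. j \<le> r x} \<Longrightarrow> y \<in> {x \<in> P. j \<le> r x} \<Longrightarrow>
        h x = h y \<Longrightarrow> x \<ge> y \<or> y \<ge> x"
    by (rule orbit_map_to_centre[where P = "{x \<in> P. j \<le> r x}" and d = "\<lambda>x. nat (r x - j)"
          and R = "\<lambda>x y. x \<ge> y", OF down_step down_inj']) (auto intro: reflpI transpI)
  define F where "F x = (if r x \<le> j then f x else h x)" for x
  have comparable: "x \<le> y \<or> y \<le> x" if "x \<in> P" "y \<in> P" "F x = F y" for x y
  proof (cases "r x \<le> j"; cases "r y \<le> j")
    assume "r x \<le> j" "r y \<le> j"
    then show ?thesis using f(2)[of x y] that by (simp add: F_def)
  next
    assume "r x \<le> j" "\<not> r y \<le> j"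
    then show ?thesis using f(1)[of x] h(1)[of y] that by (auto simp: F_def)
  next
    assume "\<not> r x \<le> j" "r y \<le> j"
    then show ?thesis using f(1)[of y] h(1)[of x] that by (auto simp: F_def)
  next
    assume "\<not> r x \<le> j" "\<not> r y \<le> j"
    then show ?thesis using h(2)[of x y] that by (auto simp: F_def)
  qed
  have "inj_on F A"
  proof (rule inj_onI)
    fix x y assume xy: "x \<in> A" "y \<in> A" "F x = F y"
    then have "x \<le> y \<or> y \<le> x" using comparable A(1) by blast
    with xy A(2) show "x = y" by (auto simp: antichain_def)
  qed
  moreover have "F ` A \<subseteq> {x \<in> P. r x = j}"
  proof (intro image_subsetI)
    fix x assume "x \<in> A"
    with A(1) have "x \<in> P" by blast
    then show "F x \<in> {x \<in> P. r x = j}"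
      using f(1)[of x] h(1)[of x] by (auto simp: F_def)
  qed
  ultimately show ?thesis
    using fin by (simp add: rank_size_def card_inj_on_le)
qed

text \<open>Each level is itself an antichain, so the bound by the middle level is attained.\<close>

lemma unimodal_sperner_if_matchings:
  fixes P :: "'a::order set" and r :: "'a \<Rightarrow> int"
  assumes fin: "finite P"
    and j: "0 \<le> j" "j \<le> Max (r ` P)"
    and strict: "\<And>x y. x \<in> P \<Longrightarrow> y \<in> P \<Longrightarrow> x < y \<Longrightarrow> r x < r y"
    and up: "\<And>x. x \<in> P \<Longrightarrow> r x < j \<Longrightarrow> U x \<in> P \<and> r (U x) = r x + 1 \<and> x \<le> U x"
    and up_inj: "\<And>i. i < j \<Longrightarrow> inj_on U {x \<in> P. r x = i}"
    and down: "\<And>x. x \<in> P \<Longrightarrow> j < r x \<Longrightarrow> D x \<in> P \<and> r (D x) = r x - 1 \<and> D x \<le> x"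
    and down_inj: "\<And>i. j < i \<Longrightarrow> inj_on D {x \<in> P. r x = i}"
  shows "rank_unimodal P r" and "sperner P r"
proof -
  have "rank_size P r i \<le> rank_size P r (i + 1)" if "i < j" for i
    unfolding rank_size_def using up that fin
    by (intro card_inj_on_le[OF up_inj[OF that]]) auto
  moreover have "rank_size P r (i + 1) \<le> rank_size P r i" if "j \<le> i" for i
    unfolding rank_size_def using down that fin
    by (intro card_inj_on_le[OF down_inj[of "i + 1"]]) auto
  ultimately show "rank_unimodal P r"
    unfolding rank_unimodal_def using j
    by (intro bexI[of _ j] conjI mono_on_int_interval antimono_on_int_interval) auto

  have bound: "card A \<le> rank_size P r j" if "A \<subseteq> P" "antichain A" for A
    by (rule antichain_card_le_middle_level[OF fin up up_inj down down_inj that])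
  have level: "antichain {x \<in> P. r x = i}" for i
    unfolding antichain_def using strict by (force simp: order_le_less)
  have "Max (card ` {A. A \<subseteq> P \<and> antichain A}) = rank_size P r j"
  proof (rule Max_eqI)
    show "finite (card ` {A. A \<subseteq> P \<and> antichain A})"
      using fin by simp
    show "rank_size P r j \<in> card ` {A. A \<subseteq> P \<and> antichain A}"
      unfolding rank_size_def using level[of j] by blast
  qed (use bound in auto)
  moreover have "Max (rank_size P r ` {0..Max (r ` P)}) = rank_size P r j"
  proof (rule Max_eqI)
    fix s assume "s \<in> rank_size P r ` {0..Max (r ` P)}"
    then obtain i where "s = card {x \<in> P. r x = i}" by (auto simp: rank_size_def)
    then show "s \<le> rank_size P r j" using bound[OF _ level[of i]] by auto
  qed (use j in auto)
  ultimately show "sperner P r" by (simp add: sperner_def)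
qed

section \<open>The exceptional sets\<close>

lemma finite_L3: "finite (L3 n)"
  by (rule finite_subset[of _ "{0..n} \<times> {0..n} \<times> {0..n}"]) (auto simp: L3_def)

text \<open>
  The parameters are recovered as \<open>k = b / 2\<close> and \<open>l = a - 2 * b\<close>. The bound on the weight becomes
  \<open>2 * (a + b) \<le> 3 * n\<close>, which follows from \<open>2 * b \<le> a \<le> n\<close>.
\<close>

lemma S3_iff:
  "(a, b, c) \<in> S3 n \<longleftrightarrow> c = 0 \<and> even b \<and> 0 \<le> b \<and> 2 * b \<le> a \<and> a \<noteq> 2 * b + 1 \<and> a \<le> n"
  (is "_ \<longleftrightarrow> ?R")
proof
  assume R: ?R
  then obtain m where m: "b = 2 * m" by (auto elim: evenE)
  have "\<exists>k l :: nat. (a, b, c) = (4 * int k + int l, 2 * int k, 0) \<and>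
      l \<noteq> 1 \<and> 4 * int k + int l \<le> n \<and> 2 * (6 * int k + int l) \<le> 3 * n"
    using R m by (intro exI[of _ "nat m"] exI[of _ "nat (a - 4 * m)"]) auto
  then show "(a, b, c) \<in> S3 n" by (simp add: S3_def)
qed (auto simp: S3_def)

lemma dual3_dual3: "dual3 n (dual3 n x) = x"
  by (cases x rule: weight.cases) simp

lemma inj_on_dual3: "inj_on (dual3 n) A"
  by (metis dual3_dual3 inj_onI)

lemma E3_iff:
  "(a, b, c) \<in> E3 n \<longleftrightarrow>
    a = n \<and> even (n - b) \<and> b \<le> n \<and> n + c \<le> 2 * b \<and> n + c + 1 \<noteq> 2 * b \<and> 0 \<le> c"
proof -
  have "(a, b, c) \<in> E3 n \<longleftrightarrow> dual3 n (a, b, c) \<in> S3 n"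
    unfolding E3_def using dual3_dual3[of n] by (auto intro: image_eqI[OF sym] simp del: dual3.simps)
  then show ?thesis by (auto simp: S3_iff)
qed

lemma S3_subset_L3: "S3 n \<subseteq> L3 n"
  by (auto simp: L3_def S3_iff)

lemma E3_subset_L3: "E3 n \<subseteq> L3 n"
  by (auto simp: L3_def E3_iff)

lemma card_L3_minus_E3: "card (L3 n - E3 n) = card (L3 n - S3 n)"
proof -
  have "card (E3 n) = card (S3 n)"
    unfolding E3_def by (rule card_image) (rule inj_on_dual3)
  then show ?thesis
    using finite_subset[OF S3_subset_L3 finite_L3, of n] finite_subset[OF E3_subset_L3 finite_L3, of n]
    by (simp add: card_Diff_subset S3_subset_L3 E3_subset_L3)
qed

lemma weight_S3: "x \<in> S3 n \<Longrightarrow> 2 * weight x \<le> 3 * n"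
  by (cases x rule: weight.cases) (auto simp: S3_iff)

lemma weight_E3: "x \<in> E3 n \<Longrightarrow> 3 * n \<le> 2 * weight x"
  by (cases x rule: weight.cases) (auto simp: E3_iff)

section \<open>The matching\<close>

text \<open>
  In the situation left open by the rules, \<open>a\<close>, \<open>b\<close> and \<open>c\<close> have the same parity, and then the
  inequalities for \<open>(a - 1, b + 1, c)\<close> imply those for \<open>(a, b, c)\<close>.
\<close>

lemma rules_exhaustive:
  assumes "(a, b, c) \<in> L3 n" "(a, b, c) \<notin> E3 a" "even (b + c)"
  shows "(a - 1, b + 1, c) \<notin> E3 (a - 1)"
proof
  assume E: "(a - 1, b + 1, c) \<in> E3 (a - 1)"
  then have "even (a - b)" by (auto simp: E3_iff)
  \<comment> \<open>with this parametrisation only linear integer inequalities remain\<close>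
  with assms(3) obtain p q where "a = b + 2 * p" "c = 2 * q - b"
    by (metis add_diff_cancel_left' add_diff_eq diff_add_cancel evenE add.commute)
  with E assms(1,2) show False by (simp add: E3_iff L3_def) presburger
qed

lemma phi_cases:
  assumes "(a, b, c) \<in> L3 n"
  obtains (raise_first) "phi (a, b, c) = (a + 1, b, c)" "(a, b, c) \<in> E3 a"
  | (raise_second_even) "phi (a, b, c) = (a, b + 1, c)" "(a, b, c) \<notin> E3 a" "even (b + c)"
      "(a - 1, b + 1, c) \<notin> E3 (a - 1)"
  | (raise_second_odd) "phi (a, b, c) = (a, b + 1, c)" "(a, b, c) \<notin> E3 a" "odd (b + c)"
      "(a - 1, b, c + 1) \<in> E3 (a - 1)"
  | (raise_third) "phi (a, b, c) = (a, b, c + 1)" "(a, b, c) \<notin> E3 a" "odd (b + c)"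
      "(a - 1, b, c + 1) \<notin> E3 (a - 1)"
  using rules_exhaustive[OF assms] by (simp only: phi.simps split: if_splits) metis

lemma weight_phi: "x \<in> L3 n \<Longrightarrow> weight (phi x) = weight x + 1"
  by (cases x rule: weight.cases, simp only:, erule phi_cases) (simp_all del: phi.simps)

lemma less_phi:
  assumes "x \<in> L3 n"
  shows "x < phi x"
proof -
  have "x \<le> phi x"
    using assms
    by (cases x rule: weight.cases, simp only:, elim phi_cases) (simp_all del: phi.simps)
  moreover have "x \<noteq> phi x"
    using weight_phi[OF assms] by auto
  ultimately show ?thesis by simp
qed

text \<open>
  The image stays a partition because an entry is only raised when it is not blocked by the
  previous one: for \<open>a = b\<close> with \<open>b + c\<close> even, the triple lies in \<open>E3 a\<close>, and for \<open>b = c\<close> the sum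
  \<open>b + c\<close> is even.

  An image in \<open>S3 n\<close> has third entry \<open>0\<close>, which excludes rule four, and an even second entry, which
  excludes rule two. For rule one and \<open>c = 0\<close> the conditions of \<^const>\<open>E3\<close> and \<^const>\<open>S3\<close> pinch the
  first entry of the image to \<open>2 * b + 1\<close>, the value that \<open>l \<noteq> 1\<close> forbids. For rule three and
  \<open>c = 0\<close> they give \<open>a \<le> 2 * b\<close> and \<open>2 * (b + 1) \<le> a\<close>.
\<close>

lemma phi_mem:
  assumes "x \<in> L3 n - E3 n"
  shows "phi x \<in> L3 n - S3 n"
proof -
  obtain a b c where x: "x = (a, b, c)" by (cases x)
  from assms x have L: "(a, b, c) \<in> L3 n" and E: "(a, b, c) \<notin> E3 n" by auto
  from L show ?thesis
  proof (cases rule: phi_cases)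
    case raise_first
    with E have "a \<noteq> n" by auto
    with raise_first L show ?thesis by (auto simp: x L3_def S3_iff E3_iff simp del: phi.simps)
  next
    case raise_second_even
    with L have "b \<noteq> a" by (auto simp: L3_def E3_iff)
    with raise_second_even L show ?thesis by (auto simp: x L3_def S3_iff simp del: phi.simps)
  next
    case raise_second_odd
    then show ?thesis using L by (auto simp: x L3_def S3_iff E3_iff simp del: phi.simps)
  next
    case raise_third
    then have "b \<noteq> c" by auto
    with raise_third L show ?thesis by (auto simp: x L3_def S3_iff simp del: phi.simps)
  qed
qed

text \<open>
  This excludes a collision between rules three and four: a triple that rule four would send to
  an image of rule three is itself exceptional, so that rule one applies to it.
\<close>

lemma E3_shift:
  assumes "(a - 1, b, 2 + c) \<in> E3 (a - 1)" "0 \<le> c"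
  shows "(a, b + 1, c) \<in> E3 a"
  using assms unfolding E3_iff by auto

text \<open>
  Two triples moved by the same rule are recovered from their images. The parities exclude equal
  images for rules one and three, two and three, and two and four. For rules one and two, or one
  and four, the triple moved by rule one is the one that the other rule requires not to be
  exceptional; rules three and four are excluded by \<open>E3_shift\<close>.
\<close>

lemma inj_on_phi: "inj_on phi (L3 n)"
proof (rule inj_onI)
  fix x y assume "x \<in> L3 n" "y \<in> L3 n" "phi x = phi y"
  moreover obtain a b c where x: "x = (a, b, c)" by (cases x)
  moreover obtain a' b' c' where y: "y = (a', b', c')" by (cases y)
  ultimately have L: "(a, b, c) \<in> L3 n" "(a', b', c') \<in> L3 n"
    and eq: "phi (a, b, c) = phi (a', b', c')" by auto
  from L have nonneg: "0 \<le> c" "0 \<le> c'" by (auto simp: L3_def)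
  have parity: "even (p - q)" if "(p, q, r) \<in> E3 p" for p q r
    using that by (simp add: E3_iff)
  note parity = parity[of a b c] parity[of "a - 1" b "c + 1"]
    parity[of a' b' c'] parity[of "a' - 1" b' "c' + 1"]
  from L(1) show "x = y"
  proof (cases rule: phi_cases)
    case raise_first
    note 1 = this
    from L(2) show ?thesis
      by (cases rule: phi_cases) (use 1 eq parity in \<open>auto simp: x y simp del: phi.simps\<close>)
  next
    case raise_second_even
    note 2 = this
    from L(2) show ?thesis
      by (cases rule: phi_cases) (use 2 eq in \<open>auto simp: x y simp del: phi.simps\<close>)
  next
    case raise_second_odd
    note 3 = this
    from L(2) show ?thesis
    proof (cases rule: phi_cases)
      case raise_third
      then show ?thesis
        using 3 eq nonneg E3_shift[of a b c'] by (auto simp: x y simp del: phi.simps)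
    qed (use 3 eq parity in \<open>auto simp: x y simp del: phi.simps\<close>)
  next
    case raise_third
    note 4 = this
    from L(2) show ?thesis
    proof (cases rule: phi_cases)
      case raise_second_odd
      then show ?thesis
        using 4 eq nonneg E3_shift[of a' b' c] by (auto simp: x y simp del: phi.simps)
    qed (use 4 eq in \<open>auto simp: x y simp del: phi.simps\<close>)
  qed
qed

lemma bij_betw_phi: "bij_betw phi (L3 n - E3 n) (L3 n - S3 n)"
proof -
  have inj: "inj_on phi (L3 n - E3 n)"
    by (rule inj_on_subset[OF inj_on_phi]) auto
  moreover have "phi ` (L3 n - E3 n) = L3 n - S3 n"
    using phi_mem finite_L3 card_image[OF inj] card_L3_minus_E3
    by (intro card_subset_eq) auto
  ultimately show ?thesis by (simp add: bij_betw_def)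
qed

lemma Max_weight_L3:
  assumes "n \<ge> 0"
  shows "Max (weight ` L3 n) = 3 * n"
proof (rule Max_eqI)
  have "(n, n, n) \<in> L3 n" using assms by (simp add: L3_def)
  then show "3 * n \<in> weight ` L3 n" by (intro image_eqI[of _ _ "(n, n, n)"]) auto
  show "finite (weight ` L3 n)" by (simp add: finite_L3)
qed (auto simp: L3_def)

lemma weight_strict_mono: "x < y \<Longrightarrow> weight x < weight y"
  by (cases x rule: weight.cases; cases y rule: weight.cases) (auto simp: less_le)

theorem theorem3:
  fixes n j :: int
  assumes "n \<ge> 1" and "j = \<lfloor>3 * real_of_int n / 2\<rfloor>"
  shows
    "(\<forall>a b c. (a, b, c) \<in> L3 n - E3 n \<longrightarrow>
        \<not> ((a, b, c) \<notin> E3 a \<and> even (b + c) \<and> (a - 1, b + 1, c) \<in> E3 (a - 1))) \<and>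
     bij_betw phi (L3 n - E3 n) (L3 n - S3 n) \<and>
     (\<forall>i. 0 \<le> i \<and> i < j \<longrightarrow>
        L3_level n i \<subseteq> L3 n - E3 n \<and>
        inj_on phi (L3_level n i) \<and>
        phi ` L3_level n i \<subseteq> L3_level n (i + 1) \<and>
        (\<forall>x \<in> L3_level n i. phi x > x)) \<and>
     (\<forall>i. j \<le> i \<and> i < 3 * n \<longrightarrow>
        L3_level n (i + 1) \<subseteq> L3 n - S3 n \<and>
        inj_on (inv_into (L3 n - E3 n) phi) (L3_level n (i + 1)) \<and>
        inv_into (L3 n - E3 n) phi ` L3_level n (i + 1) \<subseteq> L3_level n i \<and>
        (\<forall>y \<in> L3_level n (i + 1). inv_into (L3 n - E3 n) phi y < y)) \<and>
     rank_unimodal (L3 n) weight \<and>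
     sperner (L3 n) weight"
proof -
  let ?psi = "inv_into (L3 n - E3 n) phi"
  have j: "j = 3 * n div 2"
    using assms(2) by (simp add: floor_divide_of_int_eq[of "3 * n" 2, simplified])
  have bij: "bij_betw ?psi (L3 n - S3 n) (L3 n - E3 n)"
    by (rule bij_betw_inv_into) (rule bij_betw_phi)
  have phi_psi: "phi (?psi y) = y" if "y \<in> L3 n - S3 n" for y
    using bij_betw_inv_into_right[OF bij_betw_phi that] .
  have low: "L3_level n i \<subseteq> L3 n - E3 n" if "i < j" for i
    using that weight_E3[of _ n] by (fastforce simp: L3_level_def j)
  have high: "L3_level n i \<subseteq> L3 n - S3 n" if "j < i" for i
    using that weight_S3[of _ n] by (fastforce simp: L3_level_def j)
  have up: "phi x \<in> L3 n \<and> weight (phi x) = weight x + 1 \<and> x < phi x"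
    if "x \<in> L3 n - E3 n" for x
    using phi_mem[OF that] weight_phi[of x n] less_phi[of x n] that by auto
  have down: "?psi y \<in> L3 n \<and> weight (?psi y) = weight y - 1 \<and> ?psi y < y"
    if "y \<in> L3 n - S3 n" for y
  proof -
    have "?psi y \<in> L3 n - E3 n" using bij that by (rule bij_betwE[rule_format])
    with up[of "?psi y"] phi_psi[OF that] show ?thesis by auto
  qed
  have up_inj: "inj_on phi (L3_level n i)" for i
    by (rule inj_on_subset[OF inj_on_phi[of n]]) (auto simp: L3_level_def)
  have down_inj: "inj_on ?psi (L3_level n i)" if "j < i" for i
    using bij high[OF that] by (auto simp: bij_betw_def intro: inj_on_subset)

  have j_range: "0 \<le> j" "j \<le> Max (weight ` L3 n)"
    using assms(1) Max_weight_L3[of n] by (simp_all add: j)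
  have up_step: "phi x \<in> L3 n \<and> weight (phi x) = weight x + 1 \<and> x \<le> phi x"
    if "x \<in> L3 n" "weight x < j" for x
    using up[of x] low[of "weight x"] that by (auto simp: L3_level_def intro: less_imp_le)
  have down_step: "?psi x \<in> L3 n \<and> weight (?psi x) = weight x - 1 \<and> ?psi x \<le> x"
    if "x \<in> L3 n" "j < weight x" for x
    using down[of x] high[of "weight x"] that by (auto simp: L3_level_def intro: less_imp_le)
  have "rank_unimodal (L3 n) weight" "sperner (L3 n) weight"
    by (rule unimodal_sperner_if_matchings[OF finite_L3 j_range weight_strict_mono up_step
          up_inj[unfolded L3_level_def] down_step down_inj[unfolded L3_level_def]]; assumption)+
  moreover have "phi x \<in> L3_level n (i + 1)" "x < phi x" if "i < j" "x \<in> L3_level n i" for i x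
    using up[of x] low[OF that(1)] that(2) by (auto simp: L3_level_def)
  moreover have "?psi y \<in> L3_level n i" "?psi y < y"
    if "j \<le> i" "y \<in> L3_level n (i + 1)" for i y
    using down[of y] high[of "i + 1"] that by (auto simp: L3_level_def)
  moreover have "j < i + 1" if "j \<le> i" for i
    using that by simp
  ultimately show ?thesis
    using rules_exhaustive bij_betw_phi low high up_inj down_inj
    by (intro conjI allI impI image_subsetI ballI; (elim conjE)?) blast+
qed

end
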